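(* Let $T\ge 0$ be an integer, let $a_{0,j},a_{1,j}\in\mathbb{R}$ ($0\le j\le T$) be not all zero, and let $\mathcal{S}=\sum_{j=0}^T(a_{0,j}+a_{1,j}y)\partial^j$. Let $Y$ be a continuous real random variable with $\mathbb{E}|Y|<\infty$, and suppose that $\mathcal{S}$ is a Stein operator for $Y$ acting on the class $\mathcal{F}_{\mathcal{S},Y}$, i.e. $\mathbb{E}[\mathcal{S}f(Y)]=0$ for all $f\in\mathcal{F}_{\mathcal{S},Y}$. Suppose $W$ is a real-valued random variable with $\mathbb{E}|W|<\infty$. If $\mathbb{E}[\mathcal{S}f(W)]=0$ for all $f\in\mathcal{F}_{\mathcal{S},Y}$, then $W$ is equal in law to $Y$.
   Context: $\partial$ denotes differentiation with respect to $y$, so $\mathcal{S}f(y)=\sum_{j=0}^T(a_{0,j}+a_{1,j}y)f^{(j)}(y)$. For a differential operator $\mathcal{S}=\sum_{t=0}^T p_t(y)\partial^t$ with polynomial coefficients, $m=\max_{0\le t\le T}\deg p_t$, and a random variable $Y$ supported on $I\subseteq\mathbb{R}$, the class $\mathcal{F}_{\mathcal{S},Y}$ is the set of all $f\in C^T(I)$ such that $\mathbb{E}|Y^jf^{(t)}(Y)|<\infty$ for all $t=0,\ldots,T$ and $j=0,\ldots,m$. This class contains the real and imaginary parts of $y\mapsto \mathrm{e}^{\mathrm{i}ty}$, $t\in\mathbb{R}$. *)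

theory Defs
  imports "HOL-Probability.Probability" "HOL-Computational_Algebra.Polynomial"
begin

text \<open>A random variable is continuous if its distribution function is continuous (its law has
  no atoms). Random variables with a Lebesgue density are a special case.\<close>

definition continuous_rv :: "'a measure \<Rightarrow> ('a \<Rightarrow> real) \<Rightarrow> bool" where
  "continuous_rv M X \<longleftrightarrow> continuous_on UNIV (cdf (distr M borel X))"

text \<open>The class $C^k(I)$: functions that are $k$ times continuously differentiable on some open
  neighbourhood of \<open>I\<close>. For an open set \<open>I\<close> this is the usual class; for an interval that contains
  an endpoint, a function with continuous one-sided derivatives up to order \<open>k\<close> there has such an
  extension (Taylor polynomial), so up to equality on \<open>I\<close> the class is again the usual one, with
  the same derivatives on \<open>I\<close>. Values away from the neighbourhood are irrelevant junk.\<close>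

definition C_on :: "nat \<Rightarrow> real set \<Rightarrow> (real \<Rightarrow> real) set" where
  "C_on k I = {f. \<exists>U. open U \<and> I \<subseteq> U
      \<and> (\<forall>t<k. \<forall>y\<in>U. (deriv ^^ t) f field_differentiable at y)
      \<and> continuous_on U ((deriv ^^ k) f)}"

text \<open>\<open>expectation_on M X I g c\<close> says that \<open>g(X)\<close>, for a function \<open>g\<close> whose domain is \<open>I\<close>, has the
  (finite) expectation \<open>c\<close>. It is defined only if \<open>X\<close> lies in the domain of \<open>g\<close> almost surely. The
  indicator removes the junk values of \<open>g\<close> off \<open>I\<close> (on a null set only).
  For \<open>I = UNIV\<close> there is no restriction on \<open>X\<close>.\<close>

definition expectation_on ::
    "'a measure \<Rightarrow> ('a \<Rightarrow> real) \<Rightarrow> real set \<Rightarrow> (real \<Rightarrow> real) \<Rightarrow> real \<Rightarrow> bool" where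
  "expectation_on M X I g c \<longleftrightarrow> (AE \<omega> in M. X \<omega> \<in> I)
      \<and> has_bochner_integral M (\<lambda>\<omega>. indicator I (X \<omega>) * g (X \<omega>)) c"

text \<open>Operators $\sum_{t=0}^T p_t(y) \partial^t$ with polynomial coefficients.\<close>

definition diff_op :: "nat \<Rightarrow> (nat \<Rightarrow> real poly) \<Rightarrow> (real \<Rightarrow> real) \<Rightarrow> real \<Rightarrow> real" where
  "diff_op T p f y = (\<Sum>t\<le>T. poly (p t) y * (deriv ^^ t) f y)"

definition coeff_degree :: "nat \<Rightarrow> (nat \<Rightarrow> real poly) \<Rightarrow> nat" where
  "coeff_degree T p = Max ((\<lambda>t. degree (p t)) ` {..T})"

definition stein_class ::
    "nat \<Rightarrow> (nat \<Rightarrow> real poly) \<Rightarrow> real set \<Rightarrow> 'a measure \<Rightarrow> ('a \<Rightarrow> real) \<Rightarrow> (real \<Rightarrow> real) set" where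
  "stein_class T p I M Y = {f \<in> C_on T I. \<forall>t\<le>T. \<forall>j\<le>coeff_degree T p.
      \<exists>c. expectation_on M Y I (\<lambda>y. \<bar>y ^ j * (deriv ^^ t) f y\<bar>) c}"

definition linear_coeffs :: "(nat \<Rightarrow> real) \<Rightarrow> (nat \<Rightarrow> real) \<Rightarrow> nat \<Rightarrow> real poly" where
  "linear_coeffs a0 a1 j = [:a0 j, a1 j:]"

end

theory Submission
  imports Defs "HOL-Complex_Analysis.Complex_Analysis" "HOL-Real_Asymp.Real_Asymp"
begin

text \<open>Testing with the real and imaginary parts of $y \mapsto e^{ity}$ turns the Stein identity into
  a first-order linear equation $A(t)\varphi(t) - \mathrm{i}B(t)\varphi'(t) = 0$ with polynomials $A$, $B$ for both
  characteristic functions. Zeros of $B$ away from 0 are an obstacle to uniqueness, since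
  $\varphi$ may vanish there. Near 0, however, $\varphi(0) = 1$ forces every power of $t$ dividing $B$ to
  divide $A$, so after cancellation both characteristic functions equal $e^{Q}$ near 0 for one
  holomorphic $Q$. A characteristic function that is holomorphic near 0 belongs to a law with finite
  exponential moments: the iterated symmetric second difference of $\mathrm{Re}\,\varphi$ at 0 is
  $E(2 - 2\cos hX)^k$, it is at most $h^{2k}\sup |(\mathrm{Re}\,\varphi)^{(2k)}|$, and letting $h \to 0$
  (Fatou) together with the Cauchy estimates bounds $E X^{2k}$ by $C (2k)! / \rho^{2k}$. Hence both
  characteristic functions are holomorphic in a strip around the real axis and agree by the identity
  theorem.\<close>

section \<open>Complex characteristic functions\<close>

definition complex_char :: "'a measure \<Rightarrow> ('a \<Rightarrow> real) \<Rightarrow> complex \<Rightarrow> complex" where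
  "complex_char M X z = (\<integral>\<omega>. exp (\<i> * z * complex_of_real (X \<omega>)) \<partial>M)"

text \<open>Dominated convergence for the difference quotients. Convexity of \<open>S\<close> keeps
  the segment from \<open>z\<close> to \<open>u\<close> inside \<open>S\<close>, so the mean value
  inequality bounds each quotient by \<open>G\<close>. Differentiating within \<open>S\<close>
  serves both the real axis and open strips.\<close>

lemma complex_char_has_field_derivative:
  fixes X :: "'a \<Rightarrow> real"
  assumes X [measurable]: "X \<in> borel_measurable M"
    and S: "convex S" "z \<in> S"
    and G: "integrable M G"
    and bound: "\<And>\<omega> u. u \<in> S \<Longrightarrow> cmod (complex_of_real (X \<omega>) * exp (\<i> * u * complex_of_real (X \<omega>))) \<le> G \<omega>"
    and int: "\<And>u. u \<in> S \<Longrightarrow> integrable M (\<lambda>\<omega>. exp (\<i> * u * complex_of_real (X \<omega>)))"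
  shows "(complex_char M X has_field_derivative
      (\<integral>\<omega>. \<i> * complex_of_real (X \<omega>) * exp (\<i> * z * complex_of_real (X \<omega>)) \<partial>M)) (at z within S)"
  unfolding has_field_derivative_iff tendsto_at_iff_sequentially
proof (intro allI impI)
  fix u :: "nat \<Rightarrow> complex"
  assume "\<forall>i. u i \<in> S - {z}" and lim: "u \<longlonglongrightarrow> z"
  then have u: "\<And>i. u i \<in> S" "\<And>i. u i \<noteq> z" by auto
  let ?q = "\<lambda>n \<omega>. (exp (\<i> * u n * complex_of_real (X \<omega>)) - exp (\<i> * z * complex_of_real (X \<omega>))) / (u n - z)"
  have D: "((\<lambda>w. exp (\<i> * w * complex_of_real (X \<omega>))) has_field_derivative
      \<i> * complex_of_real (X \<omega>) * exp (\<i> * w * complex_of_real (X \<omega>))) (at w within S)" for w \<omega>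
    by (auto intro!: derivative_eq_intros)
  have "(\<lambda>n. \<integral>\<omega>. ?q n \<omega> \<partial>M) \<longlonglongrightarrow>
      (\<integral>\<omega>. \<i> * complex_of_real (X \<omega>) * exp (\<i> * z * complex_of_real (X \<omega>)) \<partial>M)"
  proof (rule integral_dominated_convergence[where w = G])
    show "AE \<omega> in M. (\<lambda>n. ?q n \<omega>) \<longlonglongrightarrow> \<i> * complex_of_real (X \<omega>) * exp (\<i> * z * complex_of_real (X \<omega>))"
    proof (rule AE_I2)
      fix \<omega>
      have "\<forall>v. (\<forall>i. v i \<in> S - {z}) \<longrightarrow> v \<longlonglongrightarrow> z \<longrightarrow>
         ((\<lambda>y. (exp (\<i> * y * complex_of_real (X \<omega>)) - exp (\<i> * z * complex_of_real (X \<omega>))) / (y - z)) \<circ> v)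
          \<longlonglongrightarrow> \<i> * complex_of_real (X \<omega>) * exp (\<i> * z * complex_of_real (X \<omega>))"
        using D[of \<omega> z] unfolding has_field_derivative_iff tendsto_at_iff_sequentially .
      then show "(\<lambda>n. ?q n \<omega>) \<longlonglongrightarrow> \<i> * complex_of_real (X \<omega>) * exp (\<i> * z * complex_of_real (X \<omega>))"
        using u lim by (auto simp: o_def)
    qed
    show "AE \<omega> in M. norm (?q n \<omega>) \<le> G \<omega>" for n
    proof (rule AE_I2)
      fix \<omega>
      have "cmod (exp (\<i> * u n * complex_of_real (X \<omega>)) - exp (\<i> * z * complex_of_real (X \<omega>)))
          \<le> G \<omega> * cmod (u n - z)"
        by (rule field_differentiable_bound[OF S(1) D])
          (use u S bound in \<open>auto simp: norm_mult mult.assoc\<close>)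
      then show "norm (?q n \<omega>) \<le> G \<omega>"
        using u(2)[of n] by (simp add: norm_divide divide_le_eq)
    qed
  qed (use G in auto)
  moreover have "(\<integral>\<omega>. ?q n \<omega> \<partial>M) = (complex_char M X (u n) - complex_char M X z) / (u n - z)" for n
    unfolding complex_char_def using int[OF u(1)] int[OF S(2)]
    by (subst integral_divide_zero) (simp add: Bochner_Integration.integral_diff)
  ultimately show "((\<lambda>y. (complex_char M X y - complex_char M X z) / (y - z)) \<circ> u) \<longlonglongrightarrow>
      (\<integral>\<omega>. \<i> * complex_of_real (X \<omega>) * exp (\<i> * z * complex_of_real (X \<omega>)) \<partial>M)"
    by (simp only: o_def)
qed

text \<open>For real arguments the exponential has modulus 1, so
  \<open>\<bar>X \<omega>\<bar>\<close> dominates and a first moment suffices.\<close>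

lemma complex_char_has_field_derivative_Reals:
  assumes "prob_space M" "integrable M X" "z \<in> \<real>"
  shows "(complex_char M X has_field_derivative
      \<i> * (\<integral>\<omega>. complex_of_real (X \<omega>) * exp (\<i> * z * complex_of_real (X \<omega>)) \<partial>M)) (at z within \<real>)"
proof -
  interpret prob_space M by fact
  have X [measurable]: "X \<in> borel_measurable M"
    using assms(2) by auto
  have *: "cmod (exp (\<i> * u * complex_of_real (X \<omega>))) = 1" if "u \<in> \<real>" for u \<omega>
    using that by (auto elim!: Reals_cases simp: norm_exp_eq_Re)
  have "(complex_char M X has_field_derivative
      (\<integral>\<omega>. \<i> * complex_of_real (X \<omega>) * exp (\<i> * z * complex_of_real (X \<omega>)) \<partial>M)) (at z within \<real>)"
  proof (rule complex_char_has_field_derivative[where G = "\<lambda>\<omega>. \<bar>X \<omega>\<bar>"])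
    show "integrable M (\<lambda>\<omega>. exp (\<i> * u * complex_of_real (X \<omega>)))" if "u \<in> \<real>" for u
      by (rule integrable_const_bound[where B = 1]) (simp_all only: *[OF that] AE_I2 order_refl, measurable)
  qed (use assms * in \<open>auto simp: norm_mult convex_Reals simp del: norm_exp_eq_Re\<close>)
  then show ?thesis
    by (simp add: mult.assoc)
qed

lemma complex_char_holomorphic_on_strip:
  assumes X [measurable]: "X \<in> borel_measurable M" and s: "s > 0"
    and int: "integrable M (\<lambda>\<omega>. exp (s * \<bar>X \<omega>\<bar>))"
  shows "complex_char M X holomorphic_on {z. \<bar>Im z\<bar> < s}"
proof -
  have op: "open {z. \<bar>Im z\<bar> < s}"
    by (intro open_Collect_less continuous_intros)
  have bound: "cmod (exp (\<i> * u * complex_of_real (X \<omega>))) \<le> exp (r * \<bar>X \<omega>\<bar>)" if "\<bar>Im u\<bar> \<le> r" for u \<omega> r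
  proof -
    have "- (Im u * X \<omega>) \<le> \<bar>Im u\<bar> * \<bar>X \<omega>\<bar>"
      by (metis abs_ge_minus_self abs_mult)
    also have "\<dots> \<le> r * \<bar>X \<omega>\<bar>"
      by (rule mult_right_mono) (use that in auto)
    finally show ?thesis by (simp add: norm_exp_eq_Re)
  qed
  have "\<exists>D. (complex_char M X has_field_derivative D) (at z)" if z: "\<bar>Im z\<bar> < s" for z
  proof -
    \<comment> \<open>The gap \<open>s - r\<close> leaves a factor
      \<open>exp ((s - r) * \<bar>X \<omega>\<bar>)\<close> to absorb the
      \<open>\<bar>X \<omega>\<bar>\<close> that differentiation produces.\<close>
    obtain r where r: "\<bar>Im z\<bar> < r" "r < s" using dense[OF z] by auto
    define S where "S = {u. \<bar>Im u\<bar> < r}"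
    have S: "open S" "z \<in> S" "convex S"
    proof -
      show "open S" unfolding S_def by (intro open_Collect_less continuous_intros)
      have "S = {u. Im u < r} \<inter> {u. Im u > - r}" by (auto simp: S_def)
      then show "convex S" by (simp add: convex_Int convex_halfspace_Im_lt convex_halfspace_Im_gt)
    qed (use r in \<open>auto simp: S_def\<close>)
    have "(complex_char M X has_field_derivative
        (\<integral>\<omega>. \<i> * complex_of_real (X \<omega>) * exp (\<i> * z * complex_of_real (X \<omega>)) \<partial>M)) (at z within S)"
    proof (rule complex_char_has_field_derivative[OF X S(3,2), where G = "\<lambda>\<omega>. exp (s * \<bar>X \<omega>\<bar>) / (s - r)"])
      show "integrable M (\<lambda>\<omega>. exp (s * \<bar>X \<omega>\<bar>) / (s - r))" using int by simp
      show "integrable M (\<lambda>\<omega>. exp (\<i> * u * complex_of_real (X \<omega>)))" if "u \<in> S" for u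
        by (rule Bochner_Integration.integrable_bound[OF int])
          (use that r bound[of u s] in \<open>auto simp: S_def\<close>)
      fix \<omega> u assume "u \<in> S"
      then have "cmod (complex_of_real (X \<omega>) * exp (\<i> * u * complex_of_real (X \<omega>))) \<le> \<bar>X \<omega>\<bar> * exp (r * \<bar>X \<omega>\<bar>)"
        using bound[of u r \<omega>] by (auto simp: S_def norm_mult intro!: mult_left_mono)
      also have "(s - r) * \<bar>X \<omega>\<bar> \<le> exp ((s - r) * \<bar>X \<omega>\<bar>)"
        using exp_ge_add_one_self[of "(s - r) * \<bar>X \<omega>\<bar>"] by linarith
      then have "\<bar>X \<omega>\<bar> \<le> exp ((s - r) * \<bar>X \<omega>\<bar>) / (s - r)"
        using r by (simp add: field_simps)
      then have "\<bar>X \<omega>\<bar> * exp (r * \<bar>X \<omega>\<bar>) \<le> exp ((s - r) * \<bar>X \<omega>\<bar>) / (s - r) * exp (r * \<bar>X \<omega>\<bar>)"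
        by (intro mult_right_mono) auto
      also have "\<dots> = exp (s * \<bar>X \<omega>\<bar>) / (s - r)"
        by (simp add: exp_add[symmetric] algebra_simps)
      finally show "cmod (complex_of_real (X \<omega>) * exp (\<i> * u * complex_of_real (X \<omega>))) \<le> exp (s * \<bar>X \<omega>\<bar>) / (s - r)" .
    qed
    then show ?thesis
      using S at_within_open by metis
  qed
  then show ?thesis
    by (auto simp: holomorphic_on_open[OF op])
qed

section \<open>Uniqueness of the law from agreement near 0\<close>

lemma zero_islimpt_Reals_ball:
  assumes "\<delta> > 0"
  shows "0 islimpt (\<real> \<inter> ball 0 \<delta> :: complex set)"
  unfolding islimpt_approachable
proof (intro allI impI)
  fix e :: real assume e: "e > 0"
  show "\<exists>x'\<in>\<real> \<inter> ball 0 \<delta>. x' \<noteq> 0 \<and> dist x' (0::complex) < e"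
    by (rule bexI[of _ "complex_of_real (min e \<delta> / 2)"]) (use e assms in auto)
qed

lemma char_distr_eq_complex_char:
  "X \<in> borel_measurable M \<Longrightarrow> char (distr M borel X) t = complex_char M X (of_real t)"
  unfolding char_def complex_char_def by (subst integral_distr) (auto simp: mult.assoc)

text \<open>The common strip of holomorphy is connected and contains the whole real axis, so the
  identity theorem spreads agreement from a real interval to all real arguments.\<close>

lemma distr_eq_of_complex_char_eq_near_0:
  assumes "prob_space M" "prob_space N"
    and Y [measurable]: "Y \<in> borel_measurable M" and W [measurable]: "W \<in> borel_measurable N"
    and s: "s > 0" "integrable M (\<lambda>\<omega>. exp (s * \<bar>Y \<omega>\<bar>))" "integrable N (\<lambda>\<omega>. exp (s * \<bar>W \<omega>\<bar>))"
    and \<delta>: "\<delta> > 0"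
    and eq: "\<And>z. z \<in> \<real> \<Longrightarrow> cmod z < \<delta> \<Longrightarrow> complex_char N W z = complex_char M Y z"
  shows "distr N borel W = distr M borel Y"
proof (rule Levy_uniqueness)
  show "real_distribution (distr N borel W)" "real_distribution (distr M borel Y)"
    using assms by (simp_all add: prob_space.real_distribution_distr)
  define S where "S = {z. \<bar>Im z\<bar> < s}"
  have S: "open S" "convex S"
  proof -
    show "open S" unfolding S_def by (intro open_Collect_less continuous_intros)
    have "S = {u. Im u < s} \<inter> {u. Im u > - s}" by (auto simp: S_def)
    then show "convex S" by (simp add: convex_Int convex_halfspace_Im_lt convex_halfspace_Im_gt)
  qed
  have lim: "0 islimpt (\<real> \<inter> ball 0 \<delta> :: complex set)"
    using \<delta> by (rule zero_islimpt_Reals_ball)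
  have "complex_char N W (of_real t) - complex_char M Y (of_real t) = 0" for t
  proof (rule analytic_continuation[of "\<lambda>z. complex_char N W z - complex_char M Y z" S "\<real> \<inter> ball 0 \<delta>" 0])
    show "(\<lambda>z. complex_char N W z - complex_char M Y z) holomorphic_on S"
      unfolding S_def using s by (intro holomorphic_on_diff complex_char_holomorphic_on_strip) auto
    show "\<real> \<inter> ball 0 \<delta> \<subseteq> S" using s by (auto simp: S_def complex_is_Real_iff)
  qed (use S lim s \<delta> eq in \<open>auto simp: convex_connected S_def\<close>)
  then show "char (distr N borel W) = char (distr M borel Y)"
    by (intro ext) (simp add: char_distr_eq_complex_char)
qed

section \<open>Exponential moments\<close>

text \<open>The sign is opposite to that of the usual second difference, so that cosines are
  multiplied by the nonnegative factor \<open>2 - 2 * cos (h * x)\<close>.\<close>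

definition symm_diff2 :: "real \<Rightarrow> (real \<Rightarrow> real) \<Rightarrow> real \<Rightarrow> real" where
  "symm_diff2 h f t = 2 * f t - f (t + h) - f (t - h)"

text \<open>Two mean value steps: one for the increment \<open>f (x + h) - f x\<close> between
  \<open>t - h\<close> and \<open>t\<close>, one for \<open>f'\<close> between the resulting
  \<open>z\<close> and \<open>z + h\<close>.\<close>

lemma symm_diff2_bound:
  fixes f :: "real \<Rightarrow> real"
  assumes h: "h > 0" "\<bar>t\<bar> + h < r"
    and f: "\<And>x. \<bar>x\<bar> < r \<Longrightarrow> (f has_real_derivative f' x) (at x)"
    and f': "\<And>x. \<bar>x\<bar> < r \<Longrightarrow> (f' has_real_derivative f'' x) (at x)"
    and K: "\<And>x. \<bar>x\<bar> < r \<Longrightarrow> \<bar>f'' x\<bar> \<le> K"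
  shows "\<bar>symm_diff2 h f t\<bar> \<le> h\<^sup>2 * K"
proof -
  have "\<exists>z>t - h. z < t \<and> (f (t + h) - f t) - (f (t - h + h) - f (t - h))
      = (t - (t - h)) * (f' (z + h) - f' z)"
  proof -
    have "((\<lambda>x. f (x + h) - f x) has_real_derivative f' (x + h) - f' x) (at x)"
      if "t - h \<le> x" "x \<le> t" for x
    proof -
      have "\<bar>x\<bar> < r" "\<bar>x + h\<bar> < r" using that h by linarith+
      then show ?thesis
        using f[of "x + h"] f[of x] DERIV_shift[of f "f' (x + h)" x h]
        by (intro DERIV_diff) auto
    qed
    then show ?thesis
      using MVT2[of "t - h" t "\<lambda>x. f (x + h) - f x" "\<lambda>x. f' (x + h) - f' x"] h by auto
  qed
  then obtain z where z: "t - h < z" "z < t" and 1: "(f (t + h) - f t) - (f t - f (t - h)) = h * (f' (z + h) - f' z)"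
    by auto
  have "\<exists>y>z. y < z + h \<and> f' (z + h) - f' z = (z + h - z) * f'' y"
    by (rule MVT2) (use z h in \<open>auto intro!: f'\<close>)
  then obtain y where y: "z < y" "y < z + h" and 2: "f' (z + h) - f' z = h * f'' y"
    by auto
  have "\<bar>y\<bar> < r" using y z h by linarith
  have "symm_diff2 h f t = - (h\<^sup>2 * f'' y)"
    using 1 2 by (simp add: symm_diff2_def power2_eq_square algebra_simps)
  then have "\<bar>symm_diff2 h f t\<bar> = h\<^sup>2 * \<bar>f'' y\<bar>"
    by (simp add: abs_mult)
  also have "\<dots> \<le> h\<^sup>2 * K"
    by (intro mult_left_mono K) (use \<open>\<bar>y\<bar> < r\<close> in auto)
  finally show ?thesis .
qed

text \<open>\<open>D\<close> is a chain of successive derivatives. Differencing every member gives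
  such a chain again, on the radius \<open>r - h\<close> and with bound
  \<open>h\<^sup>2 * K\<close>; hence the induction varies \<open>D\<close>, \<open>r\<close> and
  \<open>K\<close>.\<close>

lemma funpow_symm_diff2_bound:
  fixes D :: "nat \<Rightarrow> real \<Rightarrow> real"
  assumes h: "h > 0" "\<bar>t\<bar> + real k * h < r"
    and D: "\<And>n x. \<bar>x\<bar> < r \<Longrightarrow> (D n has_real_derivative D (Suc n) x) (at x)"
    and K: "\<And>x. \<bar>x\<bar> < r \<Longrightarrow> \<bar>D (n + 2 * k) x\<bar> \<le> K"
  shows "\<bar>(symm_diff2 h ^^ k) (D n) t\<bar> \<le> h ^ (2 * k) * K"
  using h(2) D K
proof (induction k arbitrary: D r K)
  case 0
  then show ?case by simp
next
  case (Suc k)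
  let ?E = "\<lambda>n. symm_diff2 h (D n)"
  have "(symm_diff2 h ^^ Suc k) (D n) t = (symm_diff2 h ^^ k) (?E n) t"
    by (simp add: funpow_swap1)
  also have "\<bar>\<dots>\<bar> \<le> h ^ (2 * k) * (h\<^sup>2 * K)"
  proof (rule Suc.IH[where r = "r - h"])
    show "\<bar>t\<bar> + real k * h < r - h" using Suc.prems(1) by (simp add: algebra_simps)
    show "(?E m has_real_derivative ?E (Suc m) x) (at x)" if "\<bar>x\<bar> < r - h" for m x
    proof -
      have "\<bar>x\<bar> < r" "\<bar>x + h\<bar> < r" "\<bar>x + - h\<bar> < r" using that h by linarith+
      from this[THEN Suc.prems(2)[of _ m]] show ?thesis
        unfolding symm_diff2_def[abs_def] diff_conv_add_uminus[of _ h]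
        by (auto simp del: add_uminus_conv_diff intro!: DERIV_diff DERIV_cmult simp flip: DERIV_shift)
    qed
    show "\<bar>?E (n + 2 * k) x\<bar> \<le> h\<^sup>2 * K" if "\<bar>x\<bar> < r - h" for x
      by (rule symm_diff2_bound[where r = r and f' = "D (Suc (n + 2 * k))" and f'' = "D (Suc (Suc (n + 2 * k)))"])
        (use that h Suc.prems(2) Suc.prems(3) in auto)
  qed
  finally show ?case by (simp add: power_add power2_eq_square algebra_simps)
qed

text \<open>By the addition formulas \<open>t \<mapsto> cos (t * x)\<close> is an eigenfunction of
  \<open>symm_diff2 h\<close>, so each application contributes one eigenvalue factor under the
  expectation.\<close>

lemma (in prob_space) funpow_symm_diff2_expectation_cos:
  fixes X :: "'a \<Rightarrow> real"
  assumes [measurable]: "random_variable borel X"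
  shows "(symm_diff2 h ^^ k) (\<lambda>t. expectation (\<lambda>\<omega>. cos (t * X \<omega>))) =
    (\<lambda>t. expectation (\<lambda>\<omega>. (2 - 2 * cos (h * X \<omega>)) ^ k * cos (t * X \<omega>)))"
proof (induction k)
  case 0
  then show ?case by simp
next
  case (Suc k)
  have int: "integrable M (\<lambda>\<omega>. (2 - 2 * cos (h * X \<omega>)) ^ k * cos (t * X \<omega>))" for t
  proof (rule integrable_const_bound[where B = "4 ^ k"])
    have "\<bar>(2 - 2 * cos (h * X \<omega>)) ^ k\<bar> * \<bar>cos (t * X \<omega>)\<bar> \<le> 4 ^ k * 1" for \<omega>
    proof (rule mult_mono)
      show "\<bar>(2 - 2 * cos (h * X \<omega>)) ^ k\<bar> \<le> 4 ^ k"
        unfolding power_abs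
        using cos_ge_minus_one[of "h * X \<omega>"] cos_le_one[of "h * X \<omega>"] by (intro power_mono) linarith+
    qed auto
    then show "AE \<omega> in M. norm ((2 - 2 * cos (h * X \<omega>)) ^ k * cos (t * X \<omega>)) \<le> 4 ^ k"
      by (simp add: abs_mult)
  qed simp
  have "(2 - 2 * cos (h * x)) ^ Suc k * cos (t * x) = 2 * ((2 - 2 * cos (h * x)) ^ k * cos (t * x))
      - (2 - 2 * cos (h * x)) ^ k * cos ((t + h) * x) - (2 - 2 * cos (h * x)) ^ k * cos ((t - h) * x)" for t x :: real
    by (simp add: cos_add cos_diff algebra_simps)
  then show ?case
    unfolding funpow.simps o_apply Suc.IH unfolding symm_diff2_def
    using int by (intro ext) (simp add: Bochner_Integration.integral_diff)
qed

section \<open>Moments of a law whose characteristic function is holomorphic near 0\<close>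

lemma has_real_derivative_Re:
  assumes "(g has_field_derivative g') (at (complex_of_real x))"
  shows "((\<lambda>t. Re (g (complex_of_real t))) has_real_derivative Re g') (at x)"
  unfolding has_real_derivative_iff_has_vector_derivative
  by (rule bounded_linear.has_vector_derivative[OF bounded_linear_Re])
    (use has_vector_derivative_real_field[OF assms] in simp)

lemma even_moment_bound:
  fixes X :: "'a \<Rightarrow> real"
  assumes "prob_space M" and X [measurable]: "X \<in> borel_measurable M"
    and g: "g holomorphic_on ball 0 (2 * \<rho>)" "\<rho> > 0" "continuous_on (cball 0 (2 * \<rho>)) g"
    and B: "\<And>z. z \<in> cball 0 (2 * \<rho>) \<Longrightarrow> cmod (g z) \<le> B"
    and eq: "\<And>t. \<bar>t\<bar> < \<rho> \<Longrightarrow> (\<integral>\<omega>. cos (t * X \<omega>) \<partial>M) = Re (g (of_real t))"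
  shows "(\<integral>\<^sup>+\<omega>. ennreal (X \<omega> ^ (2 * k)) \<partial>M) \<le> ennreal (fact (2 * k) * B / \<rho> ^ (2 * k))"
proof -
  interpret prob_space M by fact
  let ?C = "\<lambda>t. expectation (\<lambda>\<omega>. cos (t * X \<omega>))"
  \<comment> \<open>\<open>D 0\<close> is the cosine expectation on the whole line, so that the
    formula for its iterated differences, an equation between functions, applies to it. The
    agreement with \<open>g\<close> is only local.\<close>
  define D where "D n t = (if n = 0 then ?C t else Re ((deriv ^^ n) g (complex_of_real t)))" for n t
  define K where "K = fact (2 * k) * B / \<rho> ^ (2 * k)"
  have D_eq: "D n t = Re ((deriv ^^ n) g (complex_of_real t))" if "\<bar>t\<bar> < \<rho>" for n t
    using eq[OF that] by (simp add: D_def)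
  have der: "(D n has_real_derivative D (Suc n) x) (at x)" if x: "\<bar>x\<bar> < \<rho>" for n x
  proof -
    have "complex_of_real x \<in> ball 0 (2 * \<rho>)" using x g(2) by simp
    then have "((deriv ^^ n) g has_field_derivative (deriv ^^ Suc n) g (complex_of_real x)) (at (complex_of_real x))"
      using holomorphic_derivI[OF holomorphic_higher_deriv[OF g(1) open_ball, of n] open_ball] by auto
    from has_real_derivative_Re[OF this] have D:
      "((\<lambda>t. Re ((deriv ^^ n) g (complex_of_real t))) has_real_derivative D (Suc n) x) (at x)"
      by (simp add: D_def)
    have "eventually (\<lambda>t. t \<in> {-\<rho><..<\<rho>}) (nhds x)"
      by (rule eventually_nhds_in_open) (use x in auto)
    then have ev: "eventually (\<lambda>t. Re ((deriv ^^ n) g (complex_of_real t)) = D n t) (nhds x)"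
      by eventually_elim (subst D_eq, auto)
    show ?thesis
      using D DERIV_cong_ev[OF refl ev refl] by blast
  qed
  \<comment> \<open>The disc of radius \<open>\<rho>\<close> about \<open>x\<close> lies in the disc
    of radius \<open>2 * \<rho>\<close> about 0, so the Cauchy estimate has the same radius for all
    these \<open>x\<close>.\<close>
  have bound: "\<bar>D (0 + 2 * k) x\<bar> \<le> K" if x: "\<bar>x\<bar> < \<rho>" for x
  proof -
    have sub: "cball (complex_of_real x) \<rho> \<subseteq> cball 0 (2 * \<rho>)" "ball (complex_of_real x) \<rho> \<subseteq> ball 0 (2 * \<rho>)"
      using x by (auto simp: cball_subset_cball_iff ball_subset_ball_iff dist_norm)
    have "cmod ((deriv ^^ (2 * k)) g (complex_of_real x)) \<le> K" unfolding K_def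
    proof (rule Cauchy_inequality)
      show "cmod (g y) \<le> B" if "cmod (complex_of_real x - y) = \<rho>" for y
        using that sub(1) by (intro B) (auto simp: dist_norm)
    qed (use g sub in \<open>auto intro: holomorphic_on_subset continuous_on_subset\<close>)
    then show ?thesis using abs_Re_le_cmod order_trans by (auto simp: D_eq[OF x])
  qed
  \<comment> \<open>The summand \<open>k\<close> gives \<open>k * h n < \<rho>\<close> for every
    \<open>n\<close>, so that all nodes of the \<open>k\<close>-fold difference at 0 stay within
    radius \<open>\<rho>\<close>.\<close>
  define h where "h n = \<rho> / real (n + k + 2)" for n
  have h: "h n > 0" for n using g(2) by (simp add: h_def)
  let ?u = "\<lambda>n \<omega>. ((2 - 2 * cos (h n * X \<omega>)) / (h n)\<^sup>2) ^ k"
  have le: "(\<integral>\<^sup>+\<omega>. ennreal (?u n \<omega>) \<partial>M) \<le> ennreal K" for n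
  proof -
    have nn: "2 - 2 * cos x \<ge> 0" for x :: real using cos_le_one[of x] by linarith
    have "integrable M (?u n)"
    proof (rule integrable_const_bound[where B = "(4 / (h n)\<^sup>2) ^ k"])
      have "2 - 2 * cos (h n * X \<omega>) \<le> 4" for \<omega> using cos_ge_minus_one[of "h n * X \<omega>"] by linarith
      then show "AE \<omega> in M. norm (?u n \<omega>) \<le> (4 / (h n)\<^sup>2) ^ k"
        using nn by (auto simp: power_abs abs_mult simp del: power_divide intro!: power_mono divide_right_mono)
    qed simp
    then have "(\<integral>\<^sup>+\<omega>. ennreal (?u n \<omega>) \<partial>M) = ennreal (expectation (?u n))"
      using nn by (intro nn_integral_eq_integral) auto
    also have "expectation (?u n) = (symm_diff2 (h n) ^^ k) (D 0) 0 / h n ^ (2 * k)"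
      by (simp add: D_def[abs_def] funpow_symm_diff2_expectation_cos power_divide power_mult)
    also have "\<dots> \<le> K"
    proof -
      have "\<bar>(symm_diff2 (h n) ^^ k) (D 0) 0\<bar> \<le> h n ^ (2 * k) * K"
        by (rule funpow_symm_diff2_bound[where r = \<rho>, OF h _ der bound])
          (use g(2) in \<open>auto simp: h_def field_simps intro!: add_nonneg_pos\<close>)
      then show ?thesis using h[of n] by (simp add: field_simps)
    qed
    finally show ?thesis by (simp add: ennreal_leI)
  qed
  have h0: "h \<longlonglongrightarrow> 0" unfolding h_def by real_asymp
  have lim: "(\<lambda>n. ?u n \<omega>) \<longlonglongrightarrow> X \<omega> ^ (2 * k)" for \<omega>
  proof -
    have "((\<lambda>x. (2 - 2 * cos (x * y)) / x\<^sup>2) \<longlongrightarrow> y\<^sup>2) (at_right 0)" for y :: real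
      unfolding power2_eq_square by real_asymp
    moreover have "filterlim h (at_right 0) sequentially"
      using h0 h by (intro filterlim_at_withinI) auto
    ultimately have "(\<lambda>n. (2 - 2 * cos (h n * X \<omega>)) / (h n)\<^sup>2) \<longlonglongrightarrow> (X \<omega>)\<^sup>2"
      by (rule filterlim_compose)
    then show ?thesis
      unfolding power_mult by (rule tendsto_power)
  qed
  \<comment> \<open>Working with nonnegative integrals lets Fatou's lemma yield finiteness of the
    moment instead of presupposing it.\<close>
  have "(\<integral>\<^sup>+\<omega>. ennreal (X \<omega> ^ (2 * k)) \<partial>M) = (\<integral>\<^sup>+\<omega>. liminf (\<lambda>n. ennreal (?u n \<omega>)) \<partial>M)"
    using lim by (intro nn_integral_cong) (auto intro!: lim_imp_Liminf[symmetric] tendsto_ennrealI)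
  also have "\<dots> \<le> liminf (\<lambda>n. \<integral>\<^sup>+\<omega>. ennreal (?u n \<omega>) \<partial>M)"
    by (rule nn_integral_liminf) simp
  also have "\<dots> \<le> ennreal K"
    using le by (intro Liminf_le) (auto intro: always_eventually)
  finally show ?thesis by (simp add: K_def)
qed

text \<open>Only even powers occur in the series of \<open>cosh\<close>, and its factorials cancel
  those in the moment bounds. Integrating term by term leaves a geometric series in
  \<open>s / \<rho>\<close>, and \<open>2 * cosh (s * x)\<close> dominates
  \<open>exp (s * \<bar>x\<bar>)\<close>.\<close>

lemma integrable_exp_abs_of_even_moments:
  fixes X :: "'a \<Rightarrow> real"
  assumes X [measurable]: "X \<in> borel_measurable M"
    and s: "0 \<le> s" "s < \<rho>" and B: "B \<ge> 0"
    and mom: "\<And>k. (\<integral>\<^sup>+\<omega>. ennreal (X \<omega> ^ (2 * k)) \<partial>M) \<le> ennreal (fact (2 * k) * B / \<rho> ^ (2 * k))"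
  shows "integrable M (\<lambda>\<omega>. exp (s * \<bar>X \<omega>\<bar>))"
proof -
  let ?t = "\<lambda>n \<omega>. if even n then (s * X \<omega>) ^ n /\<^sub>R fact n else 0"
  have nn: "?t n \<omega> \<ge> 0" for n \<omega> by (auto simp: zero_le_even_power)
  have term_le: "(\<integral>\<^sup>+\<omega>. ennreal (?t n \<omega>) \<partial>M) \<le> ennreal (B * (s / \<rho>) ^ n)" for n
  proof (cases "even n")
    case True
    then obtain k where k: "n = 2 * k" by auto
    have "(\<integral>\<^sup>+\<omega>. ennreal (?t n \<omega>) \<partial>M) = (\<integral>\<^sup>+\<omega>. ennreal (s ^ n / fact n) * ennreal (X \<omega> ^ (2 * k)) \<partial>M)"
      using s by (intro nn_integral_cong) (subst ennreal_mult[symmetric], auto simp: k power_mult_distrib divide_inverse mult_ac zero_le_power_eq)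
    also have "\<dots> = ennreal (s ^ n / fact n) * (\<integral>\<^sup>+\<omega>. ennreal (X \<omega> ^ (2 * k)) \<partial>M)"
      by (rule nn_integral_cmult) simp
    also have "\<dots> \<le> ennreal (s ^ n / fact n) * ennreal (fact (2 * k) * B / \<rho> ^ (2 * k))"
      by (intro mult_left_mono mom) simp
    also have "\<dots> = ennreal (B * (s / \<rho>) ^ n)"
      using s B by (simp add: k power_divide field_simps flip: ennreal_mult)
    finally show ?thesis .
  qed simp
  have "(\<integral>\<^sup>+\<omega>. ennreal (cosh (s * X \<omega>)) \<partial>M) = (\<integral>\<^sup>+\<omega>. (\<Sum>n. ennreal (?t n \<omega>)) \<partial>M)"
  proof (rule nn_integral_cong)
    fix \<omega>
    show "ennreal (cosh (s * X \<omega>)) = (\<Sum>n. ennreal (?t n \<omega>))"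
      using cosh_converges[of "s * X \<omega>"] by (subst suminf_ennreal2[OF nn]) (auto simp: sums_iff)
  qed
  also have "\<dots> = (\<Sum>n. \<integral>\<^sup>+\<omega>. ennreal (?t n \<omega>) \<partial>M)"
    by (rule nn_integral_suminf) simp
  also have "\<dots> \<le> (\<Sum>n. ennreal (B * (s / \<rho>) ^ n))"
    by (intro suminf_le term_le) auto
  also have "\<dots> = ennreal (\<Sum>n. B * (s / \<rho>) ^ n)"
    using s B by (intro suminf_ennreal2) (auto intro!: summable_mult summable_geometric)
  also have "\<dots> < \<infinity>" by simp
  finally have "integrable M (\<lambda>\<omega>. cosh (s * X \<omega>))"
    by (intro integrableI_nonneg) (auto simp: cosh_field_def)
  then have "integrable M (\<lambda>\<omega>. 2 * cosh (s * X \<omega>))" by simp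
  then show ?thesis
  proof (rule Bochner_Integration.integrable_bound)
    have "exp (s * \<bar>x\<bar>) \<le> 2 * cosh (s * x)" for x
      by (cases "x \<ge> 0") (auto simp: cosh_field_def)
    then show "AE \<omega> in M. norm (exp (s * \<bar>X \<omega>\<bar>)) \<le> norm (2 * cosh (s * X \<omega>))"
      by simp
  qed simp
qed

lemma integrable_exp_abs_of_holomorphic_char:
  assumes "prob_space M" and X [measurable]: "X \<in> borel_measurable M"
    and g: "g holomorphic_on ball 0 \<delta>" "\<delta> > 0"
    and eq: "\<And>z. z \<in> \<real> \<Longrightarrow> cmod z < \<delta> \<Longrightarrow> complex_char M X z = g z"
  shows "integrable M (\<lambda>\<omega>. exp (\<delta> / 8 * \<bar>X \<omega>\<bar>))"
proof -
  interpret prob_space M by fact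
  have cont: "continuous_on (cball 0 (2 * (\<delta> / 4))) g"
    using holomorphic_on_imp_continuous_on[OF g(1)] by (rule continuous_on_subset) (use g(2) in auto)
  then obtain B where B: "\<And>z. z \<in> cball 0 (2 * (\<delta> / 4)) \<Longrightarrow> cmod (g z) \<le> B"
    using compact_imp_bounded[OF compact_continuous_image[OF cont compact_cball]]
    unfolding bounded_iff by blast
  show ?thesis
  \<comment> \<open>With \<open>\<rho> = \<delta> / 4\<close> the closed disc of radius
    \<open>2 * \<rho>\<close> is a compact part of the domain of \<open>g\<close>, which provides
    \<open>B\<close>; any positive rate below \<open>\<rho>\<close> would do for
    \<open>s\<close>.\<close>
  proof (rule integrable_exp_abs_of_even_moments[where s = "\<delta> / 8" and X = X and \<rho> = "\<delta> / 4" and B = B])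
    show "B \<ge> 0" using order_trans[OF norm_ge_zero B[of 0]] g(2) by simp
    show "(\<integral>\<^sup>+\<omega>. ennreal (X \<omega> ^ (2 * k)) \<partial>M) \<le> ennreal (fact (2 * k) * B / (\<delta> / 4) ^ (2 * k))" for k
    proof (rule even_moment_bound[where X = X and g = g])
      show "g holomorphic_on ball 0 (2 * (\<delta> / 4))"
        using g by (auto intro: holomorphic_on_subset)
      fix t :: real assume t: "\<bar>t\<bar> < \<delta> / 4"
      have "integrable M (\<lambda>\<omega>. exp (\<i> * complex_of_real t * complex_of_real (X \<omega>)))"
        by (rule integrable_const_bound[where B = 1]) auto
      then have "(\<integral>\<omega>. cos (t * X \<omega>) \<partial>M) = Re (complex_char M X (of_real t))"
        by (simp add: complex_char_def Re_exp flip: integral_Re)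
      also have "\<dots> = Re (g (of_real t))"
        using t by (subst eq) auto
      finally show "(\<integral>\<omega>. cos (t * X \<omega>) \<partial>M) = Re (g (of_real t))" .
    qed (use assms cont B in auto)
  qed (use g X in auto)
qed

section \<open>The differential equation\<close>

text \<open>The integral is $-\mathrm{i}\varphi'$ for the characteristic function $\varphi$. The equation is stated
  off 0 so that common powers of $z$ can be cancelled from \<open>A\<close> and \<open>B\<close>.\<close>

definition char_equation :: "complex poly \<Rightarrow> complex poly \<Rightarrow> 'a measure \<Rightarrow> ('a \<Rightarrow> real) \<Rightarrow> bool" where
  "char_equation A B M X \<longleftrightarrow> (\<forall>z\<in>\<real> - {0}. poly A z * complex_char M X z
     + poly B z * (\<integral>\<omega>. complex_of_real (X \<omega>) * exp (\<i> * z * complex_of_real (X \<omega>)) \<partial>M) = 0)"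

lemma complex_char_0: "prob_space M \<Longrightarrow> complex_char M X 0 = 1"
  by (simp add: complex_char_def prob_space.prob_space)

text \<open>Let \<open>z\<close> tend to 0 along the nonzero reals: the characteristic function
  tends to 1, while the integral stays bounded by the first absolute moment and is multiplied by
  \<open>poly B z\<close>, which tends to 0.\<close>

lemma char_equation_poly_0:
  assumes "prob_space M" "integrable M X" "char_equation A B M X" "poly B 0 = 0"
  shows "poly A 0 = 0"
proof -
  interpret prob_space M by fact
  let ?\<psi> = "\<lambda>z. \<integral>\<omega>. complex_of_real (X \<omega>) * exp (\<i> * z * complex_of_real (X \<omega>)) \<partial>M"
  have X [measurable]: "X \<in> borel_measurable M" using assms(2) by auto
  have "(complex_char M X \<longlongrightarrow> complex_char M X 0) (at 0 within \<real>)"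
    using DERIV_continuous[OF complex_char_has_field_derivative_Reals[OF assms(1,2), of 0]]
    by (simp add: continuous_within)
  moreover have "(poly A \<longlongrightarrow> poly A 0) (at 0 within \<real>)"
    by (intro tendsto_intros)
  ultimately have "((\<lambda>z. poly A z * complex_char M X z) \<longlongrightarrow> poly A 0 * 1) (at 0 within \<real>)"
    unfolding complex_char_0[OF assms(1)] by (intro tendsto_mult)
  moreover have "((\<lambda>z. poly B z * ?\<psi> z) \<longlongrightarrow> 0) (at 0 within \<real>)"
  proof (rule lim_null_mult_right_bounded[where B = "\<integral>\<omega>. \<bar>X \<omega>\<bar> \<partial>M"])
    have "cmod (?\<psi> z) \<le> (\<integral>\<omega>. \<bar>X \<omega>\<bar> \<partial>M)" if "z \<in> \<real>" for z
    proof -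
      have "cmod (?\<psi> z) \<le> (\<integral>\<omega>. cmod (complex_of_real (X \<omega>) * exp (\<i> * z * complex_of_real (X \<omega>))) \<partial>M)"
        by (rule integral_norm_bound)
      also have "\<dots> = (\<integral>\<omega>. \<bar>X \<omega>\<bar> \<partial>M)"
        using that by (intro Bochner_Integration.integral_cong) (auto elim!: Reals_cases simp: norm_mult)
      finally show ?thesis .
    qed
    then show "\<forall>\<^sub>F z in at 0 within \<real>. cmod (?\<psi> z) \<le> (\<integral>\<omega>. \<bar>X \<omega>\<bar> \<partial>M)"
      by (auto simp: eventually_at_filter)
    have "(poly B \<longlongrightarrow> poly B 0) (at 0 within \<real>)"
      by (intro tendsto_intros)
    then show "(poly B \<longlongrightarrow> 0) (at 0 within \<real>)"
      using assms(4) by simp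
  qed
  ultimately have "((\<lambda>z. poly A z * complex_char M X z + poly B z * ?\<psi> z) \<longlongrightarrow> poly A 0 * 1 + 0) (at 0 within \<real>)"
    by (rule tendsto_add)
  moreover have "eventually (\<lambda>z. poly A z * complex_char M X z + poly B z * ?\<psi> z = 0) (at 0 within \<real>)"
    using assms(3) by (auto simp: char_equation_def eventually_at_filter)
  ultimately have "((\<lambda>z. 0) \<longlongrightarrow> poly A 0 * 1 + 0) (at (0::complex) within \<real>)"
    by (rule Lim_transform_eventually)
  \<comment> \<open>Uniqueness of the limit needs 0 to be an accumulation point of the
    reals.\<close>
  moreover have "at (0::complex) within \<real> \<noteq> bot"
    using islimpt_subset[OF zero_islimpt_Reals_ball[of 1]] by (auto simp: trivial_limit_within)
  ultimately show ?thesis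
    by (simp add: tendsto_const_iff)
qed

text \<open>As long as \<open>B\<close> vanishes at 0, so does \<open>A\<close>, and a factor
  \<open>z\<close> can be cancelled from the equations of both laws. The descent also excludes
  \<open>B = 0\<close>, since it can only stop at a pair with
  \<open>poly B 0 \<noteq> 0\<close>.\<close>

lemma char_equation_cancel:
  assumes "prob_space M" "integrable M Y" "char_equation A B M Y" "char_equation A B N W"
    and "A \<noteq> 0 \<or> B \<noteq> 0"
  obtains A' B' where "poly B' 0 \<noteq> 0" "char_equation A' B' M Y" "char_equation A' B' N W"
proof -
  have "\<exists>A' B'. poly B' 0 \<noteq> 0 \<and> char_equation A' B' M Y \<and> char_equation A' B' N W"
    using assms(3-)
  proof (induction "degree A + degree B" arbitrary: A B rule: less_induct)
    case less
    show ?case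
    proof (cases "poly B 0 = 0")
      case True
      then have "poly A 0 = 0"
        using char_equation_poly_0 assms(1,2) less.prems(1) by blast
      obtain a A1 where A: "A = pCons a A1" by (cases A)
      obtain b B1 where B: "B = pCons b B1" by (cases B)
      have AB: "A = pCons 0 A1" "B = pCons 0 B1"
        using True \<open>poly A 0 = 0\<close> by (simp_all add: A B)
      have factor: "poly A z * u + poly B z * v = z * (poly A1 z * u + poly B1 z * v)" for z u v
        by (simp add: AB algebra_simps)
      have "char_equation A1 B1 M Y" "char_equation A1 B1 N W"
        using less.prems(1,2) unfolding char_equation_def factor by auto
      moreover have "A1 \<noteq> 0 \<or> B1 \<noteq> 0" using less.prems(3) AB by auto
      \<comment> \<open>Cancelling lowers the degree of a nonzero polynomial by one and keeps that
        of the zero polynomial at 0; at least one of the two is nonzero.\<close>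
      moreover have "degree A1 + degree B1 < degree A + degree B"
        using \<open>A1 \<noteq> 0 \<or> B1 \<noteq> 0\<close> by (auto simp: AB)
      ultimately show ?thesis using less.hyps by blast
    qed (use less.prems in blast)
  qed
  then show thesis using that by blast
qed

text \<open>Since the integral in \<open>char_equation\<close> is \<open>- \<i>\<close> times the
  derivative of the characteristic function, \<open>- \<i> * poly A z / poly B z\<close> is the
  logarithmic derivative that the equation prescribes. It is holomorphic on a disc around 0, hence
  has a primitive there; \<open>Q 0 = 0\<close> matches the value 1 at 0.\<close>

lemma log_derivative_primitive:
  fixes A B :: "complex poly"
  assumes "poly B 0 \<noteq> 0"
  obtains \<delta> Q where "\<delta> > 0" "Q 0 = 0" "\<And>z. z \<in> ball 0 \<delta> \<Longrightarrow> poly B z \<noteq> 0"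
    "\<And>z. z \<in> ball 0 \<delta> \<Longrightarrow> (Q has_field_derivative - \<i> * poly A z / poly B z) (at z)"
proof -
  have "open {z. poly B z \<noteq> 0}"
    by (intro open_Collect_neq continuous_intros)
  then obtain \<delta> where \<delta>: "\<delta> > 0" "ball 0 \<delta> \<subseteq> {z. poly B z \<noteq> 0}"
    using assms open_contains_ball by blast
  then have "(\<lambda>z. - \<i> * poly A z / poly B z) holomorphic_on ball 0 \<delta>"
    by (intro holomorphic_intros) auto
  then obtain Q where Q: "\<And>z. z \<in> ball 0 \<delta> \<Longrightarrow>
      (Q has_field_derivative - \<i> * poly A z / poly B z) (at z within ball 0 \<delta>)"
    by (rule holomorphic_convex_primitive'[OF convex_ball open_ball]) (rule that, blast)
  show thesis
  proof (rule that[of \<delta> "\<lambda>z. Q z - Q 0"])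
    show "((\<lambda>z. Q z - Q 0) has_field_derivative - \<i> * poly A z / poly B z) (at z)" if "z \<in> ball 0 \<delta>" for z
      using Q[OF that] that by (auto simp: at_within_open[OF _ open_ball] intro!: derivative_eq_intros)
  qed (use \<delta> in auto)
qed

text \<open>\<open>exp (- Q z)\<close> is an integrating factor: its product with the characteristic
  function has derivative 0. This avoids dividing by a characteristic function not yet known to be
  nonzero.\<close>

lemma complex_char_eq_exp:
  assumes "prob_space M" "integrable M X" "char_equation A B M X"
    and \<delta>: "Q 0 = 0" "\<And>z. z \<in> ball 0 \<delta> \<Longrightarrow> poly B z \<noteq> 0"
    and Q: "\<And>z. z \<in> ball 0 \<delta> \<Longrightarrow> (Q has_field_derivative - \<i> * poly A z / poly B z) (at z)"
    and z: "z \<in> \<real>" "cmod z < \<delta>"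
  shows "complex_char M X z = exp (Q z)"
proof -
  let ?S = "\<real> \<inter> ball 0 \<delta> :: complex set"
  let ?\<psi> = "\<lambda>z. \<integral>\<omega>. complex_of_real (X \<omega>) * exp (\<i> * z * complex_of_real (X \<omega>)) \<partial>M"
  let ?f = "\<lambda>z. complex_char M X z * exp (- Q z)"
  have der: "(?f has_field_derivative
      (\<i> * ?\<psi> w) * exp (- Q w) + complex_char M X w * (exp (- Q w) * (\<i> * poly A w / poly B w))) (at w within ?S)"
    if "w \<in> ?S" for w
  proof -
    have "(complex_char M X has_field_derivative \<i> * ?\<psi> w) (at w within ?S)"
      using complex_char_has_field_derivative_Reals[OF assms(1,2)] that
      by (auto intro: DERIV_subset)
    moreover have "(Q has_field_derivative - \<i> * poly A w / poly B w) (at w within ?S)"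
      using Q that by (auto intro: DERIV_subset)
    ultimately show ?thesis
      by (auto intro!: derivative_eq_intros)
  qed
  have "?f z = 1"
  \<comment> \<open>The equation says nothing at 0, so 0 is an exceptional point bridged by
    continuity; it is also the base point, where the product equals 1.\<close>
  proof (rule has_derivative_zero_unique_strong_convex[where S = ?S and K = "{0}" and f = ?f and c = 0])
    show "continuous_on ?S ?f"
      unfolding continuous_on_eq_continuous_within using DERIV_continuous[OF der] by blast
    show "(?f has_derivative (\<lambda>h. 0)) (at w within ?S)" if w: "w \<in> ?S - {0}" for w
    proof -
      have "poly A w * complex_char M X w + poly B w * ?\<psi> w = 0" "poly B w \<noteq> 0"
        using assms(3) w \<delta> by (auto simp: char_equation_def)
      then have "?\<psi> w * poly B w = - poly A w * complex_char M X w"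
        by (simp add: eq_neg_iff_add_eq_0 add.commute mult.commute)
      then have "?\<psi> w = - poly A w * complex_char M X w / poly B w"
        using nonzero_eq_divide_eq[OF \<open>poly B w \<noteq> 0\<close>] by blast
      then have "(\<i> * ?\<psi> w) * exp (- Q w) + complex_char M X w * (exp (- Q w) * (\<i> * poly A w / poly B w)) = 0"
        by (simp add: mult_ac)
      with der[of w] w have "(?f has_field_derivative 0) (at w within ?S)" by simp
      then show ?thesis unfolding has_field_derivative_def lambda_zero .
    qed
    show "0 \<in> ?S" using z by (auto intro: le_less_trans[OF norm_ge_zero])
  qed (use z \<delta> complex_char_0[OF assms(1)] in \<open>auto simp: convex_Int convex_Reals\<close>)
  then show ?thesis
    by (simp add: exp_minus field_simps)
qed

text \<open>\<open>Q\<close> is built from the polynomials alone, so one holomorphic function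
  \<open>exp (Q z)\<close> represents both characteristic functions near 0. It yields the
  exponential moments as well as the local agreement.\<close>

lemma distr_eq_of_char_equation:
  assumes "prob_space M" "prob_space N" "integrable M Y" "integrable N W"
    and "char_equation A B M Y" "char_equation A B N W" "A \<noteq> 0 \<or> B \<noteq> 0"
  shows "distr N borel W = distr M borel Y"
proof -
  obtain A' B' where AB: "poly B' 0 \<noteq> 0" "char_equation A' B' M Y" "char_equation A' B' N W"
    by (rule char_equation_cancel[OF assms(1,3,5,6,7)])
  obtain \<delta> Q where \<delta>: "\<delta> > 0" and Q: "Q 0 = 0" "\<And>z. z \<in> ball 0 \<delta> \<Longrightarrow> poly B' z \<noteq> 0"
    "\<And>z. z \<in> ball 0 \<delta> \<Longrightarrow> (Q has_field_derivative - \<i> * poly A' z / poly B' z) (at z)"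
    by (rule log_derivative_primitive[OF AB(1), of A']) blast
  have Y: "complex_char M Y z = exp (Q z)" if "z \<in> \<real>" "cmod z < \<delta>" for z
    by (rule complex_char_eq_exp[OF assms(1,3) AB(2) Q that])
  have W: "complex_char N W z = exp (Q z)" if "z \<in> \<real>" "cmod z < \<delta>" for z
    by (rule complex_char_eq_exp[OF assms(2,4) AB(3) Q that])
  have hol: "(\<lambda>z. exp (Q z)) holomorphic_on ball 0 \<delta>"
    using Q(3) by (intro holomorphic_on_exp') (unfold holomorphic_on_open[OF open_ball], blast)
  show ?thesis
  proof (rule distr_eq_of_complex_char_eq_near_0[where M = M and N = N and Y = Y and W = W and s = "\<delta> / 8" and \<delta> = \<delta>])
    show "integrable M (\<lambda>\<omega>. exp (\<delta> / 8 * \<bar>Y \<omega>\<bar>))"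
      using assms(1,3) Y
      by (intro integrable_exp_abs_of_holomorphic_char[OF _ _ hol \<delta>]) auto
    show "integrable N (\<lambda>\<omega>. exp (\<delta> / 8 * \<bar>W \<omega>\<bar>))"
      using assms(2,4) W
      by (intro integrable_exp_abs_of_holomorphic_char[OF _ _ hol \<delta>]) auto
  qed (use assms Y W \<delta> in auto)
qed

section \<open>Stein operators\<close>

text \<open>The test functions \<open>y \<mapsto> Re (c * exp (\<i> * t * y))\<close> with \<open>c \<in> {1, - \<i>}\<close> are the real and imaginary
  parts of \<open>y \<mapsto> exp (\<i> * t * y)\<close>.\<close>

definition exp_wave :: "real \<Rightarrow> complex \<Rightarrow> real \<Rightarrow> real" where
  "exp_wave t c y = Re (c * exp (\<i> * of_real t * of_real y))"

lemma exp_wave_has_real_derivative: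
  "(exp_wave t c has_real_derivative exp_wave t (c * (\<i> * of_real t)) y) (at y)"
  unfolding exp_wave_def[abs_def]
  by (rule has_real_derivative_Re) (auto intro!: derivative_eq_intros)

text \<open>Differentiation only changes the complex amplitude, which is why \<open>exp_wave\<close>
  carries an arbitrary \<open>c\<close>.\<close>

lemma higher_deriv_exp_wave:
  "(deriv ^^ j) (exp_wave t c) = exp_wave t (c * (\<i> * of_real t) ^ j)"
proof (induction j)
  case (Suc j)
  then show ?case
    by (auto intro!: ext DERIV_imp_deriv DERIV_cong[OF exp_wave_has_real_derivative] simp: mult_ac)
qed simp

lemma abs_exp_wave_le: "\<bar>exp_wave t c y\<bar> \<le> cmod c"
  unfolding exp_wave_def by (rule order_trans[OF abs_Re_le_cmod]) (simp add: norm_mult)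

lemma borel_measurable_exp_wave [measurable]: "exp_wave t c \<in> borel_measurable borel"
  unfolding exp_wave_def[abs_def] by measurable

text \<open>Waves and all their derivatives are bounded, and linear coefficients allow at most one
  power of \<open>y\<close>, so a first moment of \<open>Y\<close> suffices.\<close>

lemma exp_wave_in_stein_class:
  assumes "prob_space M" and I: "I \<in> sets borel" and YI: "AE \<omega> in M. Y \<omega> \<in> I" and Y: "integrable M Y"
  shows "exp_wave t c \<in> stein_class T (linear_coeffs a0 a1) I M Y"
proof -
  interpret prob_space M by fact
  have [measurable]: "Y \<in> borel_measurable M" "I \<in> sets borel" using assms by auto
  have "exp_wave t d field_differentiable at y" for d y
    using exp_wave_has_real_derivative by (auto simp: field_differentiable_def)
  then have "exp_wave t c \<in> C_on T I"
    unfolding C_on_def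
    by (auto simp: higher_deriv_exp_wave intro!: exI[of _ UNIV] continuous_at_imp_continuous_on
        field_differentiable_imp_continuous_at)
  moreover have "coeff_degree T (linear_coeffs a0 a1) \<le> 1"
    unfolding coeff_degree_def by (subst Max_le_iff) (auto simp: linear_coeffs_def)
  moreover have "\<exists>b. expectation_on M Y I (\<lambda>y. \<bar>y ^ j * (deriv ^^ n) (exp_wave t c) y\<bar>) b" if "j \<le> 1" for n j
  proof -
    let ?d = "c * (\<i> * of_real t) ^ n"
    have "integrable M (\<lambda>\<omega>. indicator I (Y \<omega>) * \<bar>Y \<omega> ^ j * exp_wave t ?d (Y \<omega>)\<bar>)"
    proof (rule Bochner_Integration.integrable_bound)
      show "integrable M (\<lambda>\<omega>. (1 + \<bar>Y \<omega>\<bar>) * cmod ?d)" using Y by simp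
      have "\<bar>y ^ j\<bar> \<le> 1 + \<bar>y\<bar>" for y :: real
        using that by (cases j) auto
      then have "\<bar>Y \<omega> ^ j * exp_wave t ?d (Y \<omega>)\<bar> \<le> (1 + \<bar>Y \<omega>\<bar>) * cmod ?d" for \<omega>
        unfolding abs_mult by (intro mult_mono abs_exp_wave_le) auto
      then show "AE \<omega> in M. norm (indicator I (Y \<omega>) * \<bar>Y \<omega> ^ j * exp_wave t ?d (Y \<omega>)\<bar>) \<le> norm ((1 + \<bar>Y \<omega>\<bar>) * cmod ?d)"
        by (intro AE_I2) (auto simp: indicator_def split: if_splits intro: order_trans[OF _ abs_ge_self])
    qed measurable
    then show ?thesis
      using YI unfolding expectation_on_def higher_deriv_exp_wave by (auto simp: has_bochner_integral_iff)
  qed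
  ultimately show ?thesis
    unfolding stein_class_def by (auto intro: le_trans)
qed

text \<open>The symbol of the constant-coefficient operator with coefficients \<open>a j\<close>:
  its value at \<open>t\<close> is the factor by which that operator multiplies
  \<open>exp (\<i> * t * y)\<close>.\<close>

definition fourier_poly :: "nat \<Rightarrow> (nat \<Rightarrow> real) \<Rightarrow> complex poly" where
  "fourier_poly T a = (\<Sum>j\<le>T. monom (of_real (a j) * \<i> ^ j) j)"

lemma poly_fourier_poly: "poly (fourier_poly T a) z = (\<Sum>j\<le>T. of_real (a j) * (\<i> * z) ^ j)"
  by (simp add: fourier_poly_def poly_sum poly_monom power_mult_distrib mult.assoc)

lemma fourier_poly_nonzero:
  assumes "j \<le> T" "a j \<noteq> 0"
  shows "fourier_poly T a \<noteq> 0"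
proof -
  have "coeff (fourier_poly T a) j = of_real (a j) * \<i> ^ j"
    using assms(1) by (simp add: fourier_poly_def coeff_sum)
  then show ?thesis using assms(2) by auto
qed

lemma Re_of_real_mult: "Re (complex_of_real r * w) = r * Re w"
  by simp

text \<open>The two coefficient sequences separate: \<open>a0\<close> contributes a multiple of the
  wave, \<open>a1\<close> a multiple of \<open>y\<close> times the wave. Their expectations are the
  two terms of \<open>char_equation\<close>.\<close>

lemma diff_op_exp_wave:
  "diff_op T (linear_coeffs a0 a1) (exp_wave t c) y =
    Re (c * (poly (fourier_poly T a0) (of_real t) * exp (\<i> * of_real t * of_real y)
      + poly (fourier_poly T a1) (of_real t) * (of_real y * exp (\<i> * of_real t * of_real y))))"
proof -
  let ?e = "exp (\<i> * complex_of_real t * complex_of_real y)"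
  have "poly (linear_coeffs a0 a1 j) y * (deriv ^^ j) (exp_wave t c) y
      = Re (c * (of_real (a0 j) * (\<i> * of_real t) ^ j * ?e + of_real (a1 j) * (\<i> * of_real t) ^ j * (of_real y * ?e)))" for j
  proof -
    have "poly (linear_coeffs a0 a1 j) y * (deriv ^^ j) (exp_wave t c) y
        = Re (complex_of_real (a0 j + y * a1 j) * (c * (\<i> * of_real t) ^ j * ?e))"
      unfolding higher_deriv_exp_wave exp_wave_def linear_coeffs_def Re_of_real_mult by simp
    also have "complex_of_real (a0 j + y * a1 j) * (c * (\<i> * of_real t) ^ j * ?e)
        = c * (of_real (a0 j) * (\<i> * of_real t) ^ j * ?e + of_real (a1 j) * (\<i> * of_real t) ^ j * (of_real y * ?e))"
      by (simp add: algebra_simps)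
    finally show ?thesis .
  qed
  then show ?thesis
    by (simp add: diff_op_def poly_fourier_poly sum_distrib_left sum_distrib_right sum.distrib distrib_left
        mult.assoc del: exp_of_real)
qed

lemma char_equation_of_expectation_on:
  assumes "prob_space P" and X: "integrable P X" and I: "I \<in> sets borel"
    and eq: "\<And>t c. expectation_on P X I (diff_op T (linear_coeffs a0 a1) (exp_wave t c)) 0"
  shows "char_equation (fourier_poly T a0) (fourier_poly T a1) P X"
  unfolding char_equation_def
proof
  fix z :: complex assume "z \<in> \<real> - {0}"
  then obtain t where z: "z = of_real t" by (auto elim: Reals_cases)
  interpret prob_space P by fact
  have [measurable]: "X \<in> borel_measurable P" "I \<in> sets borel" using X I by auto
  let ?A = "poly (fourier_poly T a0) z" and ?B = "poly (fourier_poly T a1) z"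
  let ?e = "\<lambda>\<omega>. exp (\<i> * z * complex_of_real (X \<omega>))"
  let ?h = "\<lambda>\<omega>. ?A * ?e \<omega> + ?B * (complex_of_real (X \<omega>) * ?e \<omega>)"
  have int1: "integrable P ?e"
    by (rule integrable_const_bound[where B = 1]) (auto simp: z)
  have int2: "integrable P (\<lambda>\<omega>. complex_of_real (X \<omega>) * ?e \<omega>)"
    by (rule Bochner_Integration.integrable_bound[OF X]) (auto simp: z norm_mult)
  have int: "integrable P ?h"
    using int1 int2 by simp
  have 0: "Re (c * (\<integral>\<omega>. ?h \<omega> \<partial>P)) = 0" for c
  proof -
    \<comment> \<open>\<open>expectation_on\<close> itself records that \<open>X\<close> lies in
      \<open>I\<close> almost surely; this removes the indicator below, for either random
      variable.\<close>
    have XI: "AE \<omega> in P. X \<omega> \<in> I" and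
      hb: "has_bochner_integral P (\<lambda>\<omega>. indicator I (X \<omega>) * Re (c * ?h \<omega>)) 0"
      using eq[of t c] unfolding expectation_on_def diff_op_exp_wave z by auto
    have "Re (c * (\<integral>\<omega>. ?h \<omega> \<partial>P)) = (\<integral>\<omega>. Re (c * ?h \<omega>) \<partial>P)"
      using int by (subst integral_Re) auto
    also have "\<dots> = (\<integral>\<omega>. indicator I (X \<omega>) * Re (c * ?h \<omega>) \<partial>P)"
      using XI by (intro integral_cong_AE) (auto simp: indicator_def)
    also have "\<dots> = 0" using hb by (simp add: has_bochner_integral_iff)
    finally show ?thesis .
  qed
  \<comment> \<open>\<open>c = 1\<close> gives the real part; \<open>c = - \<i>\<close> gives the
    imaginary part, as \<open>Re (- \<i> * w) = Im w\<close>.\<close>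
  have "(\<integral>\<omega>. ?h \<omega> \<partial>P) = 0"
    using 0[of 1] 0[of "- \<i>"] by (simp add: complex_eq_iff)
  moreover have "(\<integral>\<omega>. ?h \<omega> \<partial>P) = ?A * complex_char P X z + ?B * (\<integral>\<omega>. complex_of_real (X \<omega>) * ?e \<omega> \<partial>P)"
    using int1 int2 by (simp add: complex_char_def)
  ultimately show "?A * complex_char P X z + ?B * (\<integral>\<omega>. complex_of_real (X \<omega>) * ?e \<omega> \<partial>P) = 0"
    by simp
qed

theorem theorem2p1:
  fixes T :: nat and a0 a1 :: "nat \<Rightarrow> real"
    and M :: "'a measure" and N :: "'b measure"
    and Y :: "'a \<Rightarrow> real" and W :: "'b \<Rightarrow> real" and I :: "real set"
  assumes "\<exists>j\<le>T. a0 j \<noteq> 0 \<or> a1 j \<noteq> 0"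
    and "prob_space M" and "Y \<in> borel_measurable M"
    and "I \<in> sets borel" and "AE \<omega> in M. Y \<omega> \<in> I"
    and "continuous_rv M Y" and "integrable M Y"
    and "\<forall>f \<in> stein_class T (linear_coeffs a0 a1) I M Y.
           expectation_on M Y I (diff_op T (linear_coeffs a0 a1) f) 0"
    and "prob_space N" and "W \<in> borel_measurable N" and "integrable N W"
    and "\<forall>f \<in> stein_class T (linear_coeffs a0 a1) I M Y.
           expectation_on N W I (diff_op T (linear_coeffs a0 a1) f) 0"
  shows "distr N borel W = distr M borel Y"
proof (rule distr_eq_of_char_equation)
  \<comment> \<open>The class is determined by \<open>Y\<close>, and both Stein hypotheses range
    over it, so this one membership supplies the test functions for \<open>W\<close> too.\<close>
  have cls: "exp_wave t c \<in> stein_class T (linear_coeffs a0 a1) I M Y" for t c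
    using exp_wave_in_stein_class assms(2,4,5,7) by blast
  show "char_equation (fourier_poly T a0) (fourier_poly T a1) M Y"
    by (rule char_equation_of_expectation_on) (use assms cls in auto)
  show "char_equation (fourier_poly T a0) (fourier_poly T a1) N W"
    by (rule char_equation_of_expectation_on) (use assms cls in auto)
  show "fourier_poly T a0 \<noteq> 0 \<or> fourier_poly T a1 \<noteq> 0"
    using assms(1) fourier_poly_nonzero by blast
qed (use assms in auto)

end
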